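(* Let $k$ be a field of characteristic $p>0$. Let $M$ be a free Abelian group of finite rank $d\geq 1$, let $M_{\mathbb R}=M\otimes_{\mathbb Z}\mathbb R$, and let $\sigma\subseteq M_{\mathbb R}$ be a convex cone, not necessarily closed, such that $0\in\sigma$ and the $\mathbb R$-linear span of $\sigma$ is $M_{\mathbb R}$. Suppose that $k[\sigma\cap M]$ is split-$F$-regular. Then $\sigma$ is a closed cone generated (as a convex cone) by finitely many elements of $\sigma\cap M$. Consequently, $k[\sigma\cap M]$ is a finite type $k$-algebra.
   Context: A cone in a finite dimensional real vector space $V$ is a subset $\sigma$ such that $tx\in\sigma$ for all $x\in\sigma$ and $t\in\mathbb R_{>0}$; it is a convex cone if it is also convex. The convex cone generated by a subset $T\subseteq V$ is $\{\sum_{i=1}^r t_is_i: r\ge 1, s_i\in T, t_i\in\mathbb R_{>0}\}$. For a commutative ring $R$ of prime characteristic $p$ and $e>0$, $F^e_*R$ denotes $R$ viewed as an $R$-module by restriction of scalars along the $e$-th iterate $r\mapsto r^{p^e}$ of Frobenius; the element corresponding to $x\in R$ is written $F^e_*x$, so $r\cdot F^e_*x=F^e_*(r^{p^e}x)$. An integral domain $R$ of characteristic $p>0$ (not assumed Noetherian nor $F$-finite) is split-$F$-regular if for every $c\in R\setminus\{0\}$ there is an integer $e>0$ such that the $R$-linear map $R\to F^e_*R$, $1\mapsto F^e_*c$, splits as a map of $R$-modules. $M$ is identified with its image in $M_{\mathbb R}$; $\sigma\cap M$ is a monoid under addition, and $k[\sigma\cap M]$ is its monoid algebra. *)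

theory Defs
  imports
    "HOL-Analysis.Analysis"
    "HOL-Library.Poly_Mapping"
    "HOL-Algebra.Module"
    "HOL-Algebra.Multiplicative_Group"
    "HOL-Algebra.Generated_Rings"
begin

section \<open>Lattices and cones\<close>

text \<open>
  A free Abelian group \<open>M\<close> of finite rank \<open>d \<ge> 1\<close>, identified with its image in
  \<open>V = M \<otimes> \<real>\<close>: some \<open>\<int>\<close>-basis of \<open>M\<close> is an \<open>\<real>\<close>-basis of \<open>V\<close>.  The space \<open>V\<close> is a
  Euclidean space only to supply the usual topology of a finite-dimensional real vector space;
  its dimension is \<open>d\<close>, and it is positive for every type of class \<^class>\<open>euclidean_space\<close>.
\<close>
definition full_lattice :: "'v::euclidean_space set \<Rightarrow> bool" where
  "full_lattice M \<longleftrightarrow>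
     (\<exists>B. independent B \<and> span B = UNIV \<and>
          M = {\<Sum>b\<in>B. real_of_int (c b) *\<^sub>R b | c :: 'v \<Rightarrow> int. True})"

text \<open>
  Only positive scalars are allowed, so unlike for \<^const>\<open>cone\<close> and \<^const>\<open>conic\<close> a nonempty
  cone need not contain \<open>0\<close>.
\<close>
definition pos_cone :: "'v::real_vector set \<Rightarrow> bool" where
  "pos_cone \<sigma> \<longleftrightarrow> (\<forall>x\<in>\<sigma>. \<forall>t::real. t > 0 \<longrightarrow> t *\<^sub>R x \<in> \<sigma>)"

definition generated_convex_cone :: "'v::real_vector set \<Rightarrow> 'v set" where
  "generated_convex_cone T =
     {\<Sum>i=1..r. t i *\<^sub>R s i | (r :: nat) (t :: nat \<Rightarrow> real) (s :: nat \<Rightarrow> 'v).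
        r \<ge> 1 \<and> (\<forall>i\<in>{1..r}. s i \<in> T \<and> t i > 0)}"


section \<open>Monoid algebras\<close>

text \<open>
  For a submonoid \<open>S\<close> of \<open>'v\<close>, the monoid algebra \<open>k[S]\<close>: the multiplication of
  \<^typ>\<open>'v \<Rightarrow>\<^sub>0 'k\<close> is convolution, and \<open>Poly_Mapping.single m 1\<close> is the monomial with
  exponent \<open>m\<close>.
\<close>
definition monoid_algebra ::
    "'v::comm_monoid_add set \<Rightarrow> ('v \<Rightarrow>\<^sub>0 'k::comm_ring_1) ring" where
  "monoid_algebra S =
     \<lparr>carrier = {f. Poly_Mapping.keys f \<subseteq> S}, monoid.mult = (*), one = 1, zero = 0, add = (+)\<rparr>"

definition scalars :: "('v::comm_monoid_add \<Rightarrow>\<^sub>0 'k::comm_ring_1) set" where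
  "scalars = range (Poly_Mapping.single 0)"

text \<open>Here \<open>K\<close> is the image of the base ring in the algebra \<open>A\<close>.\<close>
definition finite_type_algebra :: "'a set \<Rightarrow> ('a, 'm) ring_scheme \<Rightarrow> bool" where
  "finite_type_algebra K A \<longleftrightarrow>
     (\<exists>G. finite G \<and> G \<subseteq> carrier A \<and> generate_ring A (K \<union> G) = carrier A)"


section \<open>Split F-regularity\<close>

text \<open>The characteristic: the additive order of \<open>1\<close>, which is \<open>0\<close> if that order is infinite.\<close>
definition ring_char :: "('a, 'm) ring_scheme \<Rightarrow> nat" where
  "ring_char R = group.ord (add_monoid R) \<one>\<^bsub>R\<^esub>"

definition self_module :: "('a, 'm) ring_scheme \<Rightarrow> ('a, 'a) module" where
  "self_module R =
     \<lparr>carrier = carrier R, monoid.mult = monoid.mult R, one = one R, zero = zero R, add = add R,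
      smult = (\<lambda>r x. r \<otimes>\<^bsub>R\<^esub> x)\<rparr>"

text \<open>The module \<open>F\<^sup>e\<^sub>*R\<close>, whose element \<open>F\<^sup>e\<^sub>*x\<close> is represented by \<open>x\<close> itself.\<close>
definition frobenius_module :: "nat \<Rightarrow> ('a, 'm) ring_scheme \<Rightarrow> ('a, 'a) module" where
  "frobenius_module e R =
     \<lparr>carrier = carrier R, monoid.mult = monoid.mult R, one = one R, zero = zero R, add = add R,
      smult = (\<lambda>r x. (r [^]\<^bsub>R\<^esub> (ring_char R ^ e)) \<otimes>\<^bsub>R\<^esub> x)\<rparr>"

definition module_homs ::
    "('a, 'm) ring_scheme \<Rightarrow> ('a, 'b, 'n) module_scheme \<Rightarrow> ('a, 'c, 'q) module_scheme \<Rightarrow> ('b \<Rightarrow> 'c) set"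
  where
  "module_homs R N P =
     {f \<in> carrier N \<rightarrow> carrier P.
        (\<forall>x\<in>carrier N. \<forall>y\<in>carrier N. f (x \<oplus>\<^bsub>N\<^esub> y) = f x \<oplus>\<^bsub>P\<^esub> f y) \<and>
        (\<forall>r\<in>carrier R. \<forall>x\<in>carrier N. f (r \<odot>\<^bsub>N\<^esub> x) = r \<odot>\<^bsub>P\<^esub> f x)}"

definition splits ::
    "('a, 'm) ring_scheme \<Rightarrow> ('a, 'b, 'n) module_scheme \<Rightarrow> ('a, 'c, 'q) module_scheme \<Rightarrow> ('b \<Rightarrow> 'c) \<Rightarrow> bool"
  where
  "splits R N P f \<longleftrightarrow> f \<in> module_homs R N P \<and> (\<exists>\<phi>\<in>module_homs R P N. \<forall>x\<in>carrier N. \<phi> (f x) = x)"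

text \<open>The map \<open>r \<mapsto> r \<cdot> F\<^sup>e\<^sub>*c\<close> is the \<open>R\<close>-linear map with \<open>1 \<mapsto> F\<^sup>e\<^sub>*c\<close>.\<close>
definition split_F_regular :: "('a, 'm) ring_scheme \<Rightarrow> bool" where
  "split_F_regular R \<longleftrightarrow>
     domain R \<and> ring_char R > 0 \<and>
     (\<forall>c\<in>carrier R - {\<zero>\<^bsub>R\<^esub>}. \<exists>e>0.
        splits R (self_module R) (frobenius_module e R) (\<lambda>r. r \<odot>\<^bsub>frobenius_module e R\<^esub> c))"

end

theory Submission
  imports Defs
begin

text \<open>
  Choose a lattice point \<open>m\<close> in the interior of \<open>\<sigma>\<close> and let \<open>S = \<sigma> \<inter> M\<close>. A splitting of
  \<open>1 \<mapsto> F\<^sup>e\<^sub>*x\<^sup>m\<close> gives, with \<open>q = p\<^sup>e\<close>, that \<open>v \<in> M\<close> and \<open>v + m/q \<in> \<sigma>\<close> imply \<open>v \<in> \<sigma>\<close>.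
  If \<open>\<sigma>\<close> is not the whole space, put \<open>h v = Sup {t. v - t m \<in> \<sigma>}\<close>. This function is superadditive
  and positively homogeneous, and on \<open>M\<close> it omits the values in \<open>(-1/q, 0)\<close>; applied to
  \<open>n v + k m\<close>, Dirichlet approximation shows that \<open>q! h\<close> is integral on \<open>M\<close>.
  An integer-valued superadditive homogeneous function on a lattice is the minimum of finitely many
  additive integer-valued functions (Hahn-Banach by iterated directional derivatives, which exist
  because bounded monotone sequences of integers become stationary). Hence \<open>S\<close> is cut out of \<open>M\<close> by
  finitely many integral inequalities and is finitely generated by Gordan's lemma. The cone over the
  generators is closed and contains the rational points of the interior of \<open>\<sigma>\<close>, so it is \<open>\<sigma>\<close>.
\<close>

section \<open>Gordan's lemma\<close>

text \<open>The submonoid generated by \<open>T\<close>, as finite sums of generators, so that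
  induction peels off one generator at a time.\<close>

inductive_set monoid_gen :: "'a::comm_monoid_add set \<Rightarrow> 'a set" for T where
  zero: "0 \<in> monoid_gen T"
| add: "t \<in> T \<Longrightarrow> s \<in> monoid_gen T \<Longrightarrow> t + s \<in> monoid_gen T"

section \<open>Monotone subsequences and Dickson's lemma\<close>

lemma monotone_subseq_nat:
  fixes s :: "nat \<Rightarrow> nat"
  obtains r :: "nat \<Rightarrow> nat" where "strict_mono r" "incseq (s \<circ> r)"
proof -
  obtain f :: "nat \<Rightarrow> nat" where f: "strict_mono f" "monoseq (\<lambda>n. s (f n))"
    using seq_monosub by blast
  then consider "incseq (\<lambda>n. s (f n))" | "decseq (\<lambda>n. s (f n))"
    by (auto simp: monoseq_iff)
  then show thesis
  proof cases
    case 1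
    then show thesis using that f(1) by (simp add: comp_def)
  next
    case 2
    \<comment> \<open>A decreasing sequence of naturals is constant from the place of its minimum
      on, so that tail is increasing too.\<close>
    obtain N where N: "\<And>n. s (f N) \<le> s (f n)"
      using arg_min_nat_le[of "\<lambda>_. True" _ "\<lambda>n. s (f n)"] by blast
    have "s (f (N + n)) = s (f N)" for n
      using N[of "N + n"] 2 by (intro antisym) (simp_all add: decseq_def)
    moreover have "strict_mono (\<lambda>n. f (N + n))"
      using f(1) by (simp add: strict_mono_def)
    ultimately show thesis
      using that[of "\<lambda>n. f (N + n)"] by (simp add: comp_def incseq_def)
  qed
qed

lemma monotone_subseq_family:
  fixes g :: "nat \<Rightarrow> 'i \<Rightarrow> nat"
  assumes "finite I"
  shows "\<exists>r::nat \<Rightarrow> nat. strict_mono r \<and> (\<forall>i\<in>I. incseq (\<lambda>n. g (r n) i))"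
  using assms
proof (induction I)
  case empty
  show ?case by (rule exI[of _ "\<lambda>n. n"]) (simp add: strict_mono_def)
next
  case (insert j I)
  then obtain r :: "nat \<Rightarrow> nat"
    where r: "strict_mono r" "\<And>i. i \<in> I \<Longrightarrow> incseq (\<lambda>n. g (r n) i)" by blast
  obtain u :: "nat \<Rightarrow> nat" where u: "strict_mono u" "incseq ((\<lambda>n. g (r n) j) \<circ> u)"
    by (rule monotone_subseq_nat)
  have "strict_mono (r \<circ> u)" using r(1) u(1) by (rule strict_mono_o)
  moreover have "incseq (\<lambda>n. g ((r \<circ> u) n) i)" if "i \<in> insert j I" for i
  proof (cases "i = j")
    case True
    then show ?thesis using u(2) by (simp add: comp_def)
  next
    case False
    then have "incseq (\<lambda>n. g (r n) i)" using that r(2) by blast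
    then show ?thesis
      using strict_mono_mono[OF u(1)] by (simp add: incseq_def mono_def)
  qed
  ultimately show ?case by blast
qed

text \<open>Otherwise elements could be picked forever, none of them above an earlier one in all
  coordinates. A subsequence along which every coordinate increases contradicts this.\<close>

lemma Dickson:
  fixes g :: "'a \<Rightarrow> 'i \<Rightarrow> nat"
  assumes I: "finite I"
  shows "\<exists>B\<subseteq>A. finite B \<and> (\<forall>a\<in>A. \<exists>b\<in>B. \<forall>i\<in>I. g b i \<le> g a i)"
proof (rule ccontr)
  assume "\<not> ?thesis"
  then have "\<forall>B\<subseteq>A. finite B \<longrightarrow> (\<exists>a. a \<in> A \<and> (\<forall>b\<in>B. \<not> (\<forall>i\<in>I. g b i \<le> g a i)))"
    by (simp add: Bex_def Ball_def)
  then have bad: "\<exists>a. a \<in> A \<and> (\<forall>b\<in>B. \<not> (\<forall>i\<in>I. g b i \<le> g a i))"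
    if "B \<subseteq> A" "finite B" for B
    using that by simp
  define pick where
    "pick B = (SOME a. a \<in> A \<and> (\<forall>b\<in>B. \<not> (\<forall>i\<in>I. g b i \<le> g a i)))" for B
  have pick: "pick B \<in> A \<and> (\<forall>b\<in>B. \<not> (\<forall>i\<in>I. g b i \<le> g (pick B) i))"
    if "B \<subseteq> A" "finite B" for B
    unfolding pick_def by (rule someI_ex[OF bad[OF that]])
  \<comment> \<open>\<open>C n\<close> collects the first \<open>n\<close> picks, so each pick is
    made against all earlier ones.\<close>
  define C where "C = rec_nat {} (\<lambda>_ B. insert (pick B) B)"
  have C_Suc: "C (Suc n) = insert (pick (C n)) (C n)" for n by (simp add: C_def)
  have C: "C n \<subseteq> A \<and> finite (C n)" for n
  proof (induction n)
    case (Suc n)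
    then show ?case using pick[of "C n"] by (simp add: C_Suc)
  qed (simp add: C_def)
  have C_mono: "C m \<subseteq> C n" if "m \<le> n" for m n
    using that by (induction rule: dec_induct) (auto simp: C_Suc)
  obtain r :: "nat \<Rightarrow> nat"
    where r: "strict_mono r" "\<And>i. i \<in> I \<Longrightarrow> incseq (\<lambda>n. g (pick (C (r n))) i)"
    using monotone_subseq_family[OF I, of "\<lambda>n. g (pick (C n))"] by blast
  have "Suc (r 0) \<le> r (Suc 0)" using r(1) by (simp add: strict_mono_def Suc_leI)
  then have "pick (C (r 0)) \<in> C (r (Suc 0))"
    using C_mono[of "Suc (r 0)" "r (Suc 0)"] C_Suc[of "r 0"] by blast
  moreover have "\<forall>i\<in>I. g (pick (C (r 0))) i \<le> g (pick (C (r (Suc 0)))) i"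
    using r(2) by (simp add: incseq_def)
  ultimately show False using pick[of "C (r (Suc 0))"] C by blast
qed

section \<open>Integral inequalities on a group\<close>

definition add_on :: "'a::ab_group_add set \<Rightarrow> ('a \<Rightarrow> int) \<Rightarrow> bool" where
  "add_on G \<phi> \<longleftrightarrow> (\<forall>x\<in>G. \<forall>y\<in>G. \<phi> (x + y) = \<phi> x + \<phi> y)"

text \<open>A predicate on sets, so that \<open>add_subgroup hull A\<close> is the subgroup
  generated by \<open>A\<close>.\<close>

definition add_subgroup :: "'a::ab_group_add set \<Rightarrow> bool" where
  "add_subgroup G \<longleftrightarrow> 0 \<in> G \<and> (\<forall>x\<in>G. \<forall>y\<in>G. x - y \<in> G)"

lemma add_subgroup_uminus:
  assumes "add_subgroup G" "x \<in> G"
  shows "- x \<in> G"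
proof -
  have "0 - x \<in> G" using assms unfolding add_subgroup_def by blast
  then show ?thesis by simp
qed

lemma add_subgroup_add:
  assumes "add_subgroup G" "x \<in> G" "y \<in> G"
  shows "x + y \<in> G"
proof -
  have "x - (- y) \<in> G"
    using assms add_subgroup_uminus[of G y] unfolding add_subgroup_def by blast
  then show ?thesis by simp
qed

lemma add_on_diff:
  assumes "add_subgroup G" "add_on G \<phi>" "x \<in> G" "y \<in> G"
  shows "\<phi> (x - y) = \<phi> x - \<phi> y"
proof -
  have "\<phi> ((x - y) + y) = \<phi> (x - y) + \<phi> y"
    using assms unfolding add_on_def add_subgroup_def by blast
  then show ?thesis by simp
qed

text \<open>\<open>L\<close> holds the inequalities and \<open>D\<close> separates nonzero elements
  from \<open>0\<close>. Dickson's lemma gives finitely many nonzero \<open>b\<close> in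
  \<open>S\<close> such that every nonzero \<open>v\<close> in \<open>S\<close> dominates one of
  them. Then \<open>v - b\<close> is again in \<open>S\<close> and smaller, and descent ends at
  \<open>0\<close>.\<close>

lemma Gordan:
  fixes G :: "'a::ab_group_add set"
  assumes G: "add_subgroup G" and "finite L" "finite D"
    and add: "\<And>\<phi>. \<phi> \<in> L \<union> D \<Longrightarrow> add_on G \<phi>"
    and inj: "\<And>v. v \<in> G \<Longrightarrow> (\<And>\<phi>. \<phi> \<in> D \<Longrightarrow> \<phi> v = 0) \<Longrightarrow> v = 0"
  defines "S \<equiv> {v \<in> G. \<forall>\<phi>\<in>L. 0 \<le> \<phi> v}"
  shows "\<exists>B\<subseteq>S. finite B \<and> S \<subseteq> monoid_gen B"
proof -
  \<comment> \<open>The boolean selects the positive or the negative part of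
    \<open>\<phi> v\<close>. Comparing both parts puts \<open>\<phi> b\<close> between
    \<open>0\<close> and \<open>\<phi> v\<close>.\<close>
  define g :: "'a \<Rightarrow> ('a \<Rightarrow> int) \<times> bool \<Rightarrow> nat" where
    "g v = (\<lambda>(\<phi>, s). nat (if s then \<phi> v else - \<phi> v))" for v
  have "finite ((L \<union> D) \<times> (UNIV :: bool set))" using assms by simp
  \<comment> \<open>\<open>0\<close> is left out: it lies below every element, and subtracting it
    makes no progress.\<close>
  from Dickson[OF this, of "S - {0}" g]
  obtain B where B: "B \<subseteq> S - {0}" "finite B"
    and dom: "\<And>v. v \<in> S - {0} \<Longrightarrow> \<exists>b\<in>B. \<forall>i\<in>(L \<union> D) \<times> UNIV. g b i \<le> g v i" by blast
  have "v \<in> monoid_gen B" if "v \<in> S" for v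
    using that
  \<comment> \<open>The measure runs over \<open>D\<close>, because all of \<open>L\<close> may
    vanish at a nonzero element, namely when the monoid contains a line.\<close>
  proof (induction "nat (\<Sum>\<phi>\<in>D. \<bar>\<phi> v\<bar>)" arbitrary: v rule: less_induct)
    case less
    show ?case
    proof (cases "v = 0")
      case True
      then show ?thesis by (simp add: monoid_gen.zero)
    next
      case False
      with less.prems obtain b where b: "b \<in> B"
        and le: "\<forall>i\<in>(L \<union> D) \<times> UNIV. g b i \<le> g v i" using dom[of v] by blast
      have bS: "b \<in> S" "b \<noteq> 0" using b B by auto
      have in_G: "v \<in> G" "b \<in> G" using bS less.prems by (auto simp: S_def)
      have diff: "\<phi> (v - b) = \<phi> v - \<phi> b" if "\<phi> \<in> L \<union> D" for \<phi>
        using add_on_diff[OF G add[OF that]] in_G by blast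
      have parts: "nat (\<phi> b) \<le> nat (\<phi> v)" "nat (- \<phi> b) \<le> nat (- \<phi> v)" if "\<phi> \<in> L \<union> D" for \<phi>
      proof -
        have "g b (\<phi>, True) \<le> g v (\<phi>, True)" "g b (\<phi>, False) \<le> g v (\<phi>, False)"
          using le that by auto
        then show "nat (\<phi> b) \<le> nat (\<phi> v)" "nat (- \<phi> b) \<le> nat (- \<phi> v)" by (auto simp: g_def)
      qed
      have "0 \<le> \<phi> (v - b)" if "\<phi> \<in> L" for \<phi>
      proof -
        have "0 \<le> \<phi> v" "0 \<le> \<phi> b" using that less.prems bS by (auto simp: S_def)
        then show ?thesis using diff[of \<phi>] parts[of \<phi>] that by auto
      qed
      then have vbS: "v - b \<in> S" using G in_G by (auto simp: S_def add_subgroup_def)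
      have abs_diff: "\<bar>\<phi> (v - b)\<bar> = \<bar>\<phi> v\<bar> - \<bar>\<phi> b\<bar>" if "\<phi> \<in> D" for \<phi>
        using diff[of \<phi>] parts[of \<phi>] that by auto
      obtain \<psi> where "\<psi> \<in> D" "\<psi> b \<noteq> 0" using inj[of b] bS in_G by blast
      then have "(\<Sum>\<phi>\<in>D. \<bar>\<phi> b\<bar>) > 0"
        by (intro sum_pos2[OF \<open>finite D\<close>]) auto
      moreover have "(\<Sum>\<phi>\<in>D. \<bar>\<phi> (v - b)\<bar>) = (\<Sum>\<phi>\<in>D. \<bar>\<phi> v\<bar>) - (\<Sum>\<phi>\<in>D. \<bar>\<phi> b\<bar>)"
        by (simp add: abs_diff sum_subtractf)
      moreover have "(\<Sum>\<phi>\<in>D. \<bar>\<phi> (v - b)\<bar>) \<ge> 0" by (simp add: sum_nonneg)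
      ultimately have "nat (\<Sum>\<phi>\<in>D. \<bar>\<phi> (v - b)\<bar>) < nat (\<Sum>\<phi>\<in>D. \<bar>\<phi> v\<bar>)" by linarith
      then have "v - b \<in> monoid_gen B" using less.hyps vbS by blast
      then have "b + (v - b) \<in> monoid_gen B" using b by (rule monoid_gen.add[rotated])
      then show ?thesis by simp
    qed
  qed
  then show ?thesis using B by blast
qed

section \<open>Bounded denominators from Dirichlet approximation\<close>

text \<open>Some \<open>n \<le> q\<close> brings \<open>n x\<close> within \<open>1/q\<close> of an
  integer; call the signed error \<open>d\<close>. The gap excludes \<open>d < 0\<close>. If
  \<open>d > 0\<close>, the multiples of \<open>d\<close> advance in steps shorter than
  \<open>1/q\<close>, so one of them lands in the gap just below \<open>1\<close>. Hence
  \<open>n x\<close> is an integer, and \<open>n\<close> divides \<open>fact q\<close>.\<close>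

lemma rational_if_multiples_avoid_gap:
  fixes x :: real and q :: nat
  assumes q: "q > 0"
    and gap: "\<And>n k. n > 0 \<Longrightarrow> real n * x + of_int k > - 1 / q \<Longrightarrow> real n * x + of_int k \<ge> 0"
  shows "of_int (fact q) * x \<in> \<int>"
proof -
  obtain l k where k: "0 < k" "k \<le> int q" "\<bar>of_int k * x - of_int l\<bar> < 1 / q"
    using Dirichlet_approx[OF q] .
  define n where "n = nat k"
  have n: "n > 0" "n \<le> q" "\<bar>real n * x - of_int l\<bar> < 1 / q" using k by (auto simp: n_def)
  define d where "d = real n * x - of_int l"
  have "d \<ge> 0" using gap[of n "-l"] n by (auto simp: d_def)
  moreover have False if "d > 0"
  proof -
    have q1: "1 / real q \<le> 1" using q by simp
    have "d < 1 / q" using n by (simp add: d_def)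
    then have "d < 1" using q1 by linarith
    \<comment> \<open>The largest \<open>j\<close> with \<open>j d < 1\<close>, so that
      \<open>- d \<le> j d - 1 < 0\<close>. The ceiling minus one, rather than the floor, keeps this
      strict when \<open>1 / d\<close> is an integer.\<close>
    define j where "j = nat (\<lceil>1 / d\<rceil> - 1)"
    have "1 / d > 1" using \<open>d < 1\<close> that by simp
    then have "\<lceil>1 / d\<rceil> > 1" by linarith
    then have j0: "j > 0" and "real j < 1 / d" "1 / d \<le> real j + 1" unfolding j_def by linarith+
    then have "real j * d < 1" "1 \<le> real j * d + d" using that by (auto simp: field_simps)
    moreover have "real (j * n) * x + of_int (- int j * l - 1) = real j * d - 1"
      by (simp add: d_def algebra_simps)
    moreover have "j * n > 0" using j0 n by simp
    ultimately show False
      using gap[of "j * n" "- int j * l - 1"] \<open>d < 1 / q\<close> by linarith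
  qed
  ultimately have "real n * x = of_int l" by (force simp: d_def)
  moreover obtain c where "fact q = n * c"
    using dvd_fact[of n q] n by (auto simp: dvd_def)
  then have "of_int (fact q) = real n * real c"
    by (metis of_int_fact of_nat_fact of_nat_mult)
  then have "of_int (fact q) * x = of_nat c * (real n * x)"
    by simp
  ultimately show ?thesis by simp
qed

section \<open>Integer-valued superadditive functions\<close>

lemma add_subgroup_scale_int:
  fixes x :: "'a::real_vector"
  assumes H: "add_subgroup H" and x: "x \<in> H"
  shows "real_of_int k *\<^sub>R x \<in> H"
proof -
  have nat: "real n *\<^sub>R x \<in> H" for n
  proof (induction n)
    case 0
    then show ?case using H by (simp add: add_subgroup_def)
  next
    case (Suc n)
    then show ?case using add_subgroup_add[OF H x] by (simp add: scaleR_add_left)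
  qed
  show ?thesis
  proof (cases "k \<ge> 0")
    case True
    then show ?thesis using nat[of "nat k"] by simp
  next
    case False
    then show ?thesis using add_subgroup_uminus[OF H nat[of "nat (- k)"]] by simp
  qed
qed

text \<open>The discrete counterpart of a concave, positively homogeneous function. Always
  \<open>f u + f (- u) \<le> 0\<close>, and equality means that \<open>f\<close> is linear along
  \<open>u\<close>; the lemmas below enlarge the set of such directions.\<close>

locale superadditive =
  fixes G :: "'a::real_vector set" and f :: "'a \<Rightarrow> int"
  assumes G: "add_subgroup G"
    and super: "\<And>u v. u \<in> G \<Longrightarrow> v \<in> G \<Longrightarrow> f u + f v \<le> f (u + v)"
    and hom: "\<And>n u. u \<in> G \<Longrightarrow> f (real n *\<^sub>R u) = int n * f u"
begin

lemma scale_mem: "u \<in> G \<Longrightarrow> real n *\<^sub>R u \<in> G"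
  using add_subgroup_scale_int[OF G, of u "int n"] by simp

lemma uminus_mem: "u \<in> G \<Longrightarrow> - u \<in> G"
  using add_subgroup_uminus[OF G] .

lemma f_zero: "f 0 = 0"
  using hom[of 0 0] G by (simp add: add_subgroup_def)

lemma f_uminus_le: "u \<in> G \<Longrightarrow> f u + f (- u) \<le> 0"
  using super[OF _ uminus_mem, of u u] f_zero by simp

text \<open>The one-sided directional derivative of \<open>f\<close> at \<open>v\<close>; the difference quotients increase
  with \<open>n\<close> and are bounded integers, so they become stationary.\<close>
lemma directional_derivative:
  assumes v: "v \<in> G"
  shows "\<exists>f'. superadditive G f' \<and> (\<forall>u\<in>G. f u \<le> f' u) \<and> f' v = f v \<and> f' (- v) = - f v"
proof -
  \<comment> \<open>By homogeneity this is the difference quotient of \<open>f\<close> at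
    \<open>v\<close> in direction \<open>u\<close> with step \<open>1/n\<close>, after clearing
    denominators to stay in the group.\<close>
  define q where "q u n = f (real n *\<^sub>R v + u) - int n * f v" for u n
  have mem: "real n *\<^sub>R v + u \<in> G" if "u \<in> G" for u n
    using that add_subgroup_add[OF G] scale_mem v by blast
  have mono: "q u n \<le> q u (Suc n)" if "u \<in> G" for u n
    using super[OF v mem[OF that], of n] by (simp add: q_def algebra_simps)
  have mono': "q u n \<le> q u n'" if "u \<in> G" "n \<le> n'" for u n n'
    using that(2) by (induction rule: dec_induct) (use mono[OF that(1)] order_trans in blast)+
  have bound: "q u n \<le> - f (- u)" if "u \<in> G" for u n
    using super[OF mem[OF that] uminus_mem[OF that], of n] hom[OF v, of n]
    by (simp add: q_def)
  have ex: "\<exists>c. \<exists>N. \<forall>n\<ge>N. q u n = c" if u: "u \<in> G" for u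
  proof -
    define k where "k n = nat (- f (- u) - q u n)" for n
    obtain N where N: "\<And>n. k N \<le> k n"
      using arg_min_nat_le[of "\<lambda>_. True" _ k] by blast
    have "q u n = q u N" if "N \<le> n" for n
      using N[of n] mono'[OF u that] bound[OF u, of n] bound[OF u, of N] by (simp add: k_def)
    then show ?thesis by blast
  qed
  define f' where "f' u = (SOME c. \<exists>N. \<forall>n\<ge>N. q u n = c)" for u
  have f': "\<exists>N. \<forall>n\<ge>N. q u n = f' u" if "u \<in> G" for u
    unfolding f'_def by (rule someI_ex[OF ex[OF that]])
  \<comment> \<open>Stage \<open>0\<close> is excluded for the sake of the direction
    \<open>- v\<close>: there \<open>n v - v = (n - 1) v\<close> is a nonnegative multiple of
    \<open>v\<close> only for \<open>n \<ge> 1\<close>.\<close>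
  have f'I: "f' u = c" if "u \<in> G" "\<And>n. n \<ge> 1 \<Longrightarrow> q u n = c" for u c
  proof -
    obtain N where "\<forall>n\<ge>N. q u n = f' u" using f' \<open>u \<in> G\<close> by blast
    then have "q u (max N 1) = f' u" by simp
    then show ?thesis using that(2)[of "max N 1"] by simp
  qed
  have sup': "f' u + f' w \<le> f' (u + w)" if in_G: "u \<in> G" "w \<in> G" for u w
  proof -
    have uw: "u + w \<in> G" using that add_subgroup_add[OF G] by blast
    obtain N1 N2 N3 where N: "\<forall>n\<ge>N1. q u n = f' u" "\<forall>n\<ge>N2. q w n = f' w"
      "\<forall>n\<ge>N3. q (u + w) n = f' (u + w)"
      using f'[OF in_G(1)] f'[OF in_G(2)] f'[OF uw] by blast
    define n where "n = max N1 (max N2 N3)"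
    \<comment> \<open>The third value is read off at \<open>n + n\<close>, since adding
      \<open>n v + u\<close> and \<open>n v + w\<close> gives
      \<open>2 n v + (u + w)\<close>.\<close>
    have "q u n = f' u" "q w n = f' w" "q (u + w) (n + n) = f' (u + w)"
      using N by (auto simp: n_def)
    moreover have "(real n *\<^sub>R v + u) + (real n *\<^sub>R v + w) = real (n + n) *\<^sub>R v + (u + w)"
      by (simp only: of_nat_add scaleR_add_left ac_simps)
    then have "q u n + q w n \<le> q (u + w) (n + n)"
      using super[OF mem[OF in_G(1), of n] mem[OF in_G(2), of n]]
      by (simp only: q_def of_nat_add distrib_right)
    ultimately show ?thesis by simp
  qed
  have hom': "f' (real m *\<^sub>R u) = int m * f' u" if u: "u \<in> G" for m u
  proof (cases "m = 0")
    case True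
    have "f' 0 = 0"
      by (rule f'I) (use G hom[OF v] in \<open>auto simp: q_def add_subgroup_def\<close>)
    then show ?thesis using True by simp
  next
    case False
    obtain N1 N2 where N: "\<forall>n\<ge>N1. q u n = f' u"
      "\<forall>n\<ge>N2. q (real m *\<^sub>R u) n = f' (real m *\<^sub>R u)"
      using f'[OF u] f'[OF scale_mem[OF u]] by blast
    define n where "n = max N1 N2"
    \<comment> \<open>Multiplying \<open>n v + u\<close> by \<open>m\<close> turns stage
      \<open>n\<close> for \<open>u\<close> into stage \<open>m n\<close> for \<open>m u\<close>,
      which is still late enough.\<close>
    have "n \<le> m * n" using False by simp
    then have "q u n = f' u" "q (real m *\<^sub>R u) (m * n) = f' (real m *\<^sub>R u)"
      using N by (auto simp: n_def)
    moreover have "q (real m *\<^sub>R u) (m * n) = int m * q u n"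
      using hom[OF mem[OF that, of n], of m] by (simp add: q_def algebra_simps)
    ultimately show ?thesis by simp
  qed
  have ge: "f u \<le> f' u" if u: "u \<in> G" for u
  proof -
    obtain N where "\<forall>n\<ge>N. q u n = f' u" using f'[OF u] by blast
    then have "q u N = f' u" by simp
    then show ?thesis using mono'[OF that, of 0 N] by (simp add: q_def)
  qed
  have "f' v = f v"
  proof (rule f'I[OF v])
    fix n :: nat assume "n \<ge> 1"
    have "real n *\<^sub>R v + v = real (Suc n) *\<^sub>R v" by (simp add: algebra_simps)
    then show "q v n = f v" using hom[OF v, of "Suc n"] by (simp add: q_def algebra_simps)
  qed
  moreover have "f' (- v) = - f v"
  proof (rule f'I[OF uminus_mem[OF v]])
    fix n :: nat assume "n \<ge> 1"
    then have "real n *\<^sub>R v + (- v) = real (n - 1) *\<^sub>R v" by (simp add: algebra_simps of_nat_diff)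
    then show "q (- v) n = - f v"
      using hom[OF v, of "n - 1"] \<open>n \<ge> 1\<close> by (simp add: q_def algebra_simps of_nat_diff)
  qed
  moreover have "superadditive G f'"
    by unfold_locales (use G sup' hom' in auto)
  ultimately show ?thesis using ge by blast
qed

text \<open>Take the directional derivative at \<open>v\<close>, then at the points of
  \<open>A\<close> one after another. Each derivative is linear along its own point and keeps the
  linearity reached before.\<close>

lemma linear_on_finite:
  assumes "finite A" "A \<subseteq> G" "v \<in> G"
  shows "\<exists>f'. superadditive G f' \<and> (\<forall>u\<in>G. f u \<le> f' u) \<and> f' v = f v \<and>
    (\<forall>a\<in>insert v A. f' a + f' (- a) = 0)"
  using assms(1,2)
proof (induction A)
  case empty
  show ?case using directional_derivative[OF assms(3)] by auto
next
  case (insert a A)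
  then obtain g where g: "superadditive G g" "\<forall>u\<in>G. f u \<le> g u" "g v = f v"
    "\<forall>a\<in>insert v A. g a + g (- a) = 0" by blast
  interpret g: superadditive G g by fact
  obtain g' where g': "superadditive G g'" "\<forall>u\<in>G. g u \<le> g' u" "g' a = g a" "g' (- a) = - g a"
    using g.directional_derivative[of a] insert.prems by blast
  interpret g': superadditive G g' by fact
  \<comment> \<open>If \<open>g\<close> is linear along \<open>w\<close> and
    \<open>g' \<ge> g\<close>, then \<open>0 = g w + g (- w) \<le> g' w + g' (- w) \<le> 0\<close>,
    so neither value has changed.\<close>
  have keep: "g' w = g w \<and> g' w + g' (- w) = 0" if "w \<in> insert v A" for w
  proof -
    have w: "w \<in> G" "- w \<in> G" using that insert.prems assms(3) uminus_mem by auto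
    then show ?thesis using g'(2) g(4) g'.f_uminus_le[OF w(1)] that by (smt (verit))
  qed
  show ?case
  proof (intro exI[of _ g'] conjI ballI)
    show "f u \<le> g' u" if "u \<in> G" for u using that g(2) g'(2) order_trans by blast
    show "g' v = f v" using keep[of v] g(3) by simp
    show "g' b + g' (- b) = 0" if "b \<in> insert v (insert a A)" for b
      using that keep g'(3,4) by auto
  qed fact
qed

text \<open>Superadditivity at \<open>- u\<close> and \<open>- v\<close> gives the upper bound
  \<open>f (u + v) \<le> - f (- (u + v)) \<le> f u + f v\<close>.\<close>

lemma linear_add:
  assumes "u \<in> G" "v \<in> G" "f u + f (- u) = 0" "f v + f (- v) = 0"
  shows "f (u + v) = f u + f v"
proof -
  have "f (- u) + f (- v) \<le> f (- (u + v))"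
    using super[of "- u" "- v"] assms uminus_mem by simp
  moreover have "f (u + v) + f (- (u + v)) \<le> 0"
    using f_uminus_le add_subgroup_add[OF G] assms by blast
  ultimately show ?thesis using super[of u v] assms by linarith
qed

end

text \<open>A supporting functional at \<open>v\<close>: once \<open>f\<close> is enlarged to be
  linear along the generators, the directions of linearity form a subgroup containing them, hence
  all of \<open>G\<close>.\<close>

lemma integer_Hahn_Banach:
  assumes f: "superadditive G f" and A: "finite A" "A \<subseteq> G" and v: "v \<in> G"
    and gen: "G \<subseteq> add_subgroup hull A"
  shows "\<exists>\<phi>. add_on G \<phi> \<and> (\<forall>u\<in>G. f u \<le> \<phi> u) \<and> \<phi> v = f v"
proof -
  interpret superadditive G f by fact
  obtain g where g: "superadditive G g" "\<forall>u\<in>G. f u \<le> g u" "g v = f v"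
    "\<forall>a\<in>A. g a + g (- a) = 0"
    using linear_on_finite[OF A v] by blast
  interpret g: superadditive G g by fact
  define H where "H = {u \<in> G. g u + g (- u) = 0}"
  have "add_subgroup H"
    unfolding add_subgroup_def
  proof (intro conjI ballI)
    show "0 \<in> H" using G g.f_zero by (simp add: H_def add_subgroup_def)
    fix x y assume xy: "x \<in> H" "y \<in> H"
    then have "x \<in> G" "- x \<in> G" "y \<in> G" "- y \<in> G" "g x + g (- x) = 0" "g y + g (- y) = 0"
      using uminus_mem by (auto simp: H_def)
    then have "g (x + - y) = g x + g (- y)" "g (- x + y) = g (- x) + g y"
      using g.linear_add[of x "- y"] g.linear_add[of "- x" y] by simp_all
    then show "x - y \<in> H" using xy G by (auto simp: H_def add_subgroup_def)
  qed
  moreover have "A \<subseteq> H" using A g(4) by (auto simp: H_def)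
  ultimately have "G \<subseteq> H" using gen hull_minimal[of A H add_subgroup] by blast
  then have "add_on G g" unfolding add_on_def H_def using g.linear_add by blast
  then show ?thesis using g by blast
qed

text \<open>An additive \<open>\<phi> \<ge> f\<close> satisfies \<open>f a \<le> \<phi> a \<le> - f (- a)\<close> at each generator \<open>a\<close>, so there are only
  finitely many of them.\<close>
lemma nonneg_locus_finitely_cut_out:
  assumes f: "superadditive G f" and A: "finite A" "A \<subseteq> G"
    and gen: "G \<subseteq> add_subgroup hull A"
  shows "\<exists>L. finite L \<and> (\<forall>\<phi>\<in>L. add_on G \<phi>) \<and> {v \<in> G. 0 \<le> f v} = {v \<in> G. \<forall>\<phi>\<in>L. 0 \<le> \<phi> v}"
proof -
  interpret superadditive G f by fact
  define L0 where "L0 = {\<phi>. add_on G \<phi> \<and> (\<forall>u\<in>G. f u \<le> \<phi> u)}"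
  \<comment> \<open>Members of \<open>L0\<close> are unconstrained outside \<open>G\<close>. Setting
    them to \<open>0\<close> there makes each one determined by its values on the
    generators.\<close>
  define L where "L = (\<lambda>\<phi> v. if v \<in> G then \<phi> v else 0) ` L0"
  have zero_diff: "\<phi> 0 = 0 \<and> (\<forall>x\<in>G. \<forall>y\<in>G. \<phi> (x - y) = \<phi> x - \<phi> y)" if "add_on G \<phi>" for \<phi>
    using add_on_diff[OF G that, of 0 0] add_on_diff[OF G that] G
    by (simp add: add_subgroup_def)
  have "(\<lambda>\<phi>. restrict \<phi> A) ` L \<subseteq> (\<Pi>\<^sub>E a\<in>A. {f a..- f (- a)})"
  proof (rule image_subsetI)
    fix \<phi> assume "\<phi> \<in> L"
    then obtain \<psi> where \<psi>: "add_on G \<psi>" "\<forall>u\<in>G. f u \<le> \<psi> u" "\<phi> = (\<lambda>v. if v \<in> G then \<psi> v else 0)"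
      by (auto simp: L_def L0_def)
    have "\<psi> a \<in> {f a..- f (- a)}" if "a \<in> A" for a
    proof -
      have a: "a \<in> G" "0 \<in> G" using that A G by (auto simp: add_subgroup_def)
      have "\<psi> (0 - a) = \<psi> 0 - \<psi> a" using zero_diff[OF \<psi>(1)] a by blast
      then show ?thesis
        using zero_diff[OF \<psi>(1)] \<psi>(2) uminus_mem[OF a(1)] a by fastforce
    qed
    then show "restrict \<phi> A \<in> (\<Pi>\<^sub>E a\<in>A. {f a..- f (- a)})" using A \<psi>(3) by auto
  qed
  then have "finite ((\<lambda>\<phi>. restrict \<phi> A) ` L)"
    by (rule finite_subset) (use A in \<open>auto intro: finite_PiE\<close>)
  moreover have "inj_on (\<lambda>\<phi>. restrict \<phi> A) L"
  proof (rule inj_onI)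
    fix \<phi>1 \<phi>2 assume "\<phi>1 \<in> L" "\<phi>2 \<in> L" and eq: "restrict \<phi>1 A = restrict \<phi>2 A"
    then obtain \<psi>1 \<psi>2 where \<psi>: "add_on G \<psi>1" "\<phi>1 = (\<lambda>v. if v \<in> G then \<psi>1 v else 0)"
      "add_on G \<psi>2" "\<phi>2 = (\<lambda>v. if v \<in> G then \<psi>2 v else 0)" by (auto simp: L_def L0_def)
    have "A \<subseteq> {u \<in> G. \<psi>1 u = \<psi>2 u}"
    proof
      fix a assume "a \<in> A"
      then have "\<phi>1 a = \<phi>2 a" using fun_cong[OF eq, of a] by simp
      then show "a \<in> {u \<in> G. \<psi>1 u = \<psi>2 u}" using \<open>a \<in> A\<close> A \<psi> by auto
    qed
    moreover have "add_subgroup {u \<in> G. \<psi>1 u = \<psi>2 u}"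
      using zero_diff[OF \<psi>(1)] zero_diff[OF \<psi>(3)] G by (auto simp: add_subgroup_def)
    ultimately have "add_subgroup hull A \<subseteq> {u \<in> G. \<psi>1 u = \<psi>2 u}" by (rule hull_minimal)
    then have "G \<subseteq> {u \<in> G. \<psi>1 u = \<psi>2 u}" using gen by (rule order_trans[rotated])
    then show "\<phi>1 = \<phi>2" unfolding \<psi>(2,4) by (intro ext) auto
  qed
  ultimately have "finite L" by (rule finite_imageD)
  moreover have "\<forall>\<phi>\<in>L. add_on G \<phi>"
    using add_subgroup_add[OF G] by (auto simp: L_def L0_def add_on_def)
  moreover have "0 \<le> \<phi> v" if "v \<in> G" "0 \<le> f v" "\<phi> \<in> L" for v \<phi>
    using that by (force simp: L_def L0_def)
  moreover have "0 \<le> f v" if v: "v \<in> G" "\<forall>\<phi>\<in>L. 0 \<le> \<phi> v" for v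
  proof -
    \<comment> \<open>The functional supporting \<open>f\<close> at \<open>v\<close> belongs to
      \<open>L0\<close> and attains \<open>f v\<close>, so its nonnegativity at \<open>v\<close> is
      that of \<open>f\<close>.\<close>
    obtain \<phi> where "add_on G \<phi>" "\<forall>u\<in>G. f u \<le> \<phi> u" "\<phi> v = f v"
      using integer_Hahn_Banach[OF f A v(1) gen] by blast
    then show ?thesis using v by (force simp: L_def L0_def)
  qed
  ultimately have "finite L \<and> (\<forall>\<phi>\<in>L. add_on G \<phi>) \<and>
      {v \<in> G. 0 \<le> f v} = {v \<in> G. \<forall>\<phi>\<in>L. 0 \<le> \<phi> v}"
    by auto
  then show ?thesis by (rule exI)
qed

section \<open>Monoid algebras and splittings\<close>

lemma single_pow_monoid_algebra:
  fixes w :: "'v::real_vector"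
  shows "Poly_Mapping.single w (1::'k::comm_ring_1) [^]\<^bsub>monoid_algebra S\<^esub> (n::nat) =
    Poly_Mapping.single (real n *\<^sub>R w) 1"
  by (induction n) (simp_all add: nat_pow_def monoid_algebra_def mult_single algebra_simps)

text \<open>The splitting \<open>\<phi>\<close> of \<open>1 \<mapsto> F^e_* x^m\<close> sends
  \<open>x^(q u + m)\<close> to \<open>x^u\<close> and takes out \<open>q\<close>-th powers of
  monomials. For \<open>z = m + q (u - w)\<close> in \<open>S\<close> this yields
  \<open>x^u = x^w \<phi> (x^z)\<close>, so \<open>u - w\<close> is an exponent of
  \<open>\<phi> (x^z)\<close> and lies in \<open>S\<close>.\<close>

lemma split_F_regular_root_closed:
  fixes S :: "'v::real_vector set"
  assumes reg: "split_F_regular (monoid_algebra S :: ('v \<Rightarrow>\<^sub>0 'k::field) ring)"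
    and S: "\<And>x y. x \<in> S \<Longrightarrow> y \<in> S \<Longrightarrow> x + y \<in> S" "m \<in> S"
  shows "\<exists>q>0. \<forall>u\<in>S. \<forall>w\<in>S. m + real q *\<^sub>R (u - w) \<in> S \<longrightarrow> u - w \<in> S"
proof -
  define R where "R = (monoid_algebra S :: ('v \<Rightarrow>\<^sub>0 'k) ring)"
  define X where "X w = Poly_Mapping.single w (1::'k)" for w :: 'v
  have X: "X w \<in> carrier R" if "w \<in> S" for w
    using that by (simp add: X_def R_def monoid_algebra_def)
  have X_mult: "X u * X w = X (u + w)" for u w by (simp add: X_def mult_single)
  have "X m \<noteq> 0"
    by (metis X_def keys_single keys_zero insert_not_empty zero_neq_one)
  then have "X m \<in> carrier R - {\<zero>\<^bsub>R\<^esub>}"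
    using X[OF S(2)] by (simp add: R_def monoid_algebra_def)
  moreover have "split_F_regular R" using reg by (simp add: R_def)
  ultimately obtain e where pos: "ring_char R > 0"
    and sp: "splits R (self_module R) (frobenius_module e R) (\<lambda>r. r \<odot>\<^bsub>frobenius_module e R\<^esub> X m)"
    unfolding split_F_regular_def by blast
  define q where "q = ring_char R ^ e"
  obtain \<phi> where \<phi>: "\<phi> \<in> module_homs R (frobenius_module e R) (self_module R)"
    and id: "\<forall>x\<in>carrier (self_module R). \<phi> (x \<odot>\<^bsub>frobenius_module e R\<^esub> X m) = x"
    using sp unfolding splits_def by blast
  have mult_R: "x \<otimes>\<^bsub>R\<^esub> y = x * y" for x y by (simp add: R_def monoid_algebra_def)
  have pow: "X w [^]\<^bsub>R\<^esub> (ring_char R ^ e) = X (real q *\<^sub>R w)" for w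
    unfolding X_def R_def q_def by (rule single_pow_monoid_algebra)
  have \<phi>_id: "\<phi> (X (real q *\<^sub>R w + m)) = X w" if "w \<in> S" for w
    using bspec[OF id, of "X w"] X[OF that] by (simp add: self_module_def frobenius_module_def pow mult_R X_mult)
  have \<phi>_lin: "\<phi> (X (real q *\<^sub>R w + u)) = X w * \<phi> (X u)" if "w \<in> S" "u \<in> S" for u w
  proof -
    have "\<phi> (X w \<odot>\<^bsub>frobenius_module e R\<^esub> X u) = X w \<odot>\<^bsub>self_module R\<^esub> \<phi> (X u)"
      using \<phi> X that unfolding module_homs_def by (simp add: frobenius_module_def)
    then show ?thesis by (simp add: self_module_def frobenius_module_def pow mult_R X_mult)
  qed
  have \<phi>_keys: "Poly_Mapping.keys (\<phi> (X u)) \<subseteq> S" if "u \<in> S" for u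
  proof -
    have "\<phi> (X u) \<in> carrier R"
      using \<phi> X[OF that] unfolding module_homs_def
      by (auto simp: frobenius_module_def self_module_def)
    then show ?thesis by (simp add: R_def monoid_algebra_def)
  qed
  have "u - w \<in> S" if uw: "u \<in> S" "w \<in> S" and in_S: "m + real q *\<^sub>R (u - w) \<in> S" for u w
  proof -
    define z where "z = m + real q *\<^sub>R (u - w)"
    \<comment> \<open>The same exponent written in two ways: linearity applies to the left side, the
      splitting identity to the right side.\<close>
    have "real q *\<^sub>R w + z = real q *\<^sub>R u + m" by (simp add: z_def algebra_simps)
    moreover have "z \<in> S" using in_S by (simp add: z_def)
    ultimately have "X u = X w * \<phi> (X z)"
      using \<phi>_id[OF uw(1)] \<phi>_lin[OF uw(2), of z] by simp
    moreover have "Poly_Mapping.keys (X u) = {u}" by (simp add: X_def)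
    ultimately have "u \<in> Poly_Mapping.keys (X w * \<phi> (X z))" by simp
    then obtain s where "s \<in> Poly_Mapping.keys (\<phi> (X z))" "u = w + s"
      using keys_mult[of "X w" "\<phi> (X z)"] by (auto simp: X_def split: if_splits)
    then show ?thesis using \<phi>_keys[of z] in_S by (auto simp: z_def)
  qed
  then show ?thesis using pos by (intro exI[of _ q]) (simp add: q_def)
qed

lemma poly_mapping_eq_sum_single:
  fixes f :: "'a \<Rightarrow>\<^sub>0 'b::comm_monoid_add"
  shows "f = (\<Sum>k\<in>Poly_Mapping.keys f. Poly_Mapping.single k (Poly_Mapping.lookup f k))"
  by (rule poly_mapping_eqI)
    (auto simp: lookup_sum lookup_single when_def in_keys_iff)

text \<open>The monomials with exponents in \<open>B\<close> generate: a term \<open>c x^s\<close>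
  is the scalar \<open>c\<close> times a product of them, and every element is a finite sum of such
  terms.\<close>

lemma finite_type_monoid_algebra:
  fixes S :: "'v::comm_monoid_add set"
  assumes R: "ring (monoid_algebra S :: ('v \<Rightarrow>\<^sub>0 'k::comm_ring_1) ring)"
    and B: "finite B" "B \<subseteq> S" "S \<subseteq> monoid_gen B" and "0 \<in> S"
  shows "finite_type_algebra scalars (monoid_algebra S :: ('v \<Rightarrow>\<^sub>0 'k) ring)"
proof -
  define R where "R = (monoid_algebra S :: ('v \<Rightarrow>\<^sub>0 'k) ring)"
  interpret ring R using R by (simp add: R_def)
  define Y where "Y = (\<lambda>t. Poly_Mapping.single t (1::'k)) ` B"
  have Y: "Y \<subseteq> carrier R" using B by (auto simp: Y_def R_def monoid_algebra_def)
  have sc: "scalars \<subseteq> carrier R"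
    using \<open>0 \<in> S\<close> by (auto simp: scalars_def R_def monoid_algebra_def split: if_splits)
  have add_R: "x \<oplus>\<^bsub>R\<^esub> y = x + y" and mult_R: "x \<otimes>\<^bsub>R\<^esub> y = x * y" for x y
    by (simp_all add: R_def monoid_algebra_def)
  define E where "E = generate_ring R (scalars \<union> Y)"
  have single: "Poly_Mapping.single s c \<in> E" if "s \<in> monoid_gen B" for s c
    using that
  proof induction
    case zero
    show ?case unfolding E_def by (rule generate_ring.incl) (auto simp: scalars_def)
  next
    case (add t s)
    have "Poly_Mapping.single t 1 \<in> E"
      unfolding E_def using add.hyps(1) by (intro generate_ring.incl) (auto simp: Y_def)
    then have "Poly_Mapping.single t 1 \<otimes>\<^bsub>R\<^esub> Poly_Mapping.single s c \<in> E"
      using add.IH unfolding E_def by (rule generate_ring.eng_mult)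
    then show ?case by (simp add: mult_R mult_single)
  qed
  have "(\<Sum>k\<in>K. Poly_Mapping.single k (g k)) \<in> E" if "finite K" "K \<subseteq> S" for K g
    using that
  proof induction
    case empty
    have "\<zero>\<^bsub>R\<^esub> \<in> E" unfolding E_def by (rule zero_in_generate)
    then show ?case by (simp add: R_def monoid_algebra_def)
  next
    case (insert k K)
    then have "Poly_Mapping.single k (g k) \<oplus>\<^bsub>R\<^esub> (\<Sum>k\<in>K. Poly_Mapping.single k (g k)) \<in> E"
      using single[of k "g k"] B(3) unfolding E_def by (intro generate_ring.eng_add) auto
    then show ?case using insert.hyps by (simp add: add_R)
  qed
  then have "f \<in> E" if "f \<in> carrier R" for f
    using that by (subst poly_mapping_eq_sum_single) (simp add: R_def monoid_algebra_def)
  moreover have "E \<subseteq> carrier R"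
    unfolding E_def using Y sc by (intro generate_ring_incl) auto
  ultimately have "E = carrier R" by blast
  then show ?thesis
    unfolding finite_type_algebra_def R_def[symmetric]
    using B(1) Y by (intro exI[of _ Y]) (simp add: E_def Y_def)
qed

section \<open>Full lattices\<close>

lemma full_lattice_basis:
  fixes M :: "'v::euclidean_space set"
  assumes "full_lattice M"
  obtains B where "finite B" "independent B" "span B = UNIV"
    "M = {\<Sum>b\<in>B. real_of_int (c b) *\<^sub>R b | c :: 'v \<Rightarrow> int. True}"
proof -
  obtain B where B: "independent B" "span B = UNIV"
    "M = {\<Sum>b\<in>B. real_of_int (c b) *\<^sub>R b | c :: 'v \<Rightarrow> int. True}"
    using assms unfolding full_lattice_def by blast
  with that[of B] show thesis by (simp add: independent_imp_finite)
qed

lemma full_lattice_add_subgroup: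
  fixes M :: "'v::euclidean_space set"
  assumes "full_lattice M"
  shows "add_subgroup M"
proof -
  obtain B where B: "finite B" "independent B" "span B = UNIV"
    "M = {\<Sum>b\<in>B. real_of_int (c b) *\<^sub>R b | c :: 'v \<Rightarrow> int. True}"
    by (rule full_lattice_basis[OF assms])
  have comb: "(\<Sum>b\<in>B. real_of_int (c b) *\<^sub>R b) \<in> M" for c unfolding B(4) by blast
  from comb[of "\<lambda>_. 0"] have "0 \<in> M" by simp
  moreover have "x - y \<in> M" if "x \<in> M" "y \<in> M" for x y
  proof -
    obtain c d where "x = (\<Sum>b\<in>B. real_of_int (c b) *\<^sub>R b)" "y = (\<Sum>b\<in>B. real_of_int (d b) *\<^sub>R b)"
      using \<open>x \<in> M\<close> \<open>y \<in> M\<close> unfolding B(4) by blast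
    then have "x - y = (\<Sum>b\<in>B. real_of_int (c b - d b) *\<^sub>R b)"
      by (simp add: sum_subtractf scaleR_diff_left)
    then show ?thesis using comb[of "\<lambda>b. c b - d b"] by (simp only:)
  qed
  ultimately show ?thesis by (simp add: add_subgroup_def)
qed

lemma full_lattice_generators:
  fixes M :: "'v::euclidean_space set"
  assumes "full_lattice M"
  obtains B where "finite B" "B \<subseteq> M" "M \<subseteq> add_subgroup hull B"
proof -
  obtain B where B: "finite B" "independent B" "span B = UNIV"
    "M = {\<Sum>b\<in>B. real_of_int (c b) *\<^sub>R b | c :: 'v \<Rightarrow> int. True}"
    by (rule full_lattice_basis[OF assms])
  have "b \<in> M" if "b \<in> B" for b
  proof -
    have "(\<Sum>a\<in>B. real_of_int (if a = b then 1 else 0) *\<^sub>R a) = (\<Sum>a\<in>B. if a = b then a else 0)"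
      by (rule sum.cong) auto
    also have "\<dots> = b" using B(1) that by simp
    finally show ?thesis unfolding B(4) by (intro CollectI exI[of _ "\<lambda>a. if a = b then 1 else 0"]) simp
  qed
  moreover have "M \<subseteq> H" if H: "B \<subseteq> H" "add_subgroup H" for H
  proof -
    have "(\<Sum>b\<in>C. real_of_int (c b) *\<^sub>R b) \<in> H" if "finite C" "C \<subseteq> H" for C c
      using that
    proof induction
      case empty
      then show ?case using H(2) by (simp add: add_subgroup_def)
    next
      case (insert b C)
      then show ?case
        using add_subgroup_add[OF H(2)] add_subgroup_scale_int[OF H(2)] by simp
    qed
    then show ?thesis using B(1,4) H(1) by auto
  qed
  then have "M \<subseteq> add_subgroup hull B" unfolding hull_def by blast
  ultimately show thesis using that[of B] B(1) by blast
qed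

lemma full_lattice_coordinates:
  fixes M :: "'v::euclidean_space set"
  assumes "full_lattice M"
  obtains D where "finite D" "\<And>\<phi>. \<phi> \<in> D \<Longrightarrow> add_on M \<phi>"
    "\<And>v. v \<in> M \<Longrightarrow> (\<And>\<phi>. \<phi> \<in> D \<Longrightarrow> \<phi> v = 0) \<Longrightarrow> v = 0"
proof -
  obtain B where B: "finite B" "independent B" "span B = UNIV"
    "M = {\<Sum>b\<in>B. real_of_int (c b) *\<^sub>R b | c :: 'v \<Rightarrow> int. True}"
    by (rule full_lattice_basis[OF assms])
  \<comment> \<open>The floor only changes the type to \<open>int\<close>: coordinates of lattice
    points are already integers.\<close>
  define co where "co b v = \<lfloor>representation B v b\<rfloor>" for b v
  have rep: "representation B (\<Sum>b\<in>B. real_of_int (c b) *\<^sub>R b) b = real_of_int (c b)"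
    if "b \<in> B" for b c
  proof -
    have "representation B (\<Sum>b\<in>B. real_of_int (c b) *\<^sub>R b) b =
        (\<Sum>a\<in>B. real_of_int (c a) * representation B a b)"
      using B by (simp add: representation_sum representation_scale)
    also have "\<dots> = (\<Sum>a\<in>B. if a = b then real_of_int (c b) else 0)"
      using B that by (intro sum.cong) (auto simp: representation_basis)
    finally show ?thesis using B that by simp
  qed
  have repM: "real_of_int (co b v) = representation B v b" if "b \<in> B" "v \<in> M" for b v
    using that rep unfolding B(4) co_def by auto
  have "add_on M (co b)" if "b \<in> B" for b
    unfolding add_on_def
  proof (intro ballI)
    fix x y assume xy: "x \<in> M" "y \<in> M"
    then have "x + y \<in> M" using add_subgroup_add[OF full_lattice_add_subgroup[OF assms]] by blast
    then have "real_of_int (co b (x + y)) = real_of_int (co b x + co b y)"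
      using repM[OF that] xy B by (simp add: representation_add)
    then show "co b (x + y) = co b x + co b y" by (simp only: of_int_eq_iff)
  qed
  moreover have "v = 0" if "v \<in> M" "\<And>\<phi>. \<phi> \<in> co ` B \<Longrightarrow> \<phi> v = 0" for v
  proof -
    have "representation B v b = 0" if "b \<in> B" for b
      using repM[OF that \<open>v \<in> M\<close>] that \<open>\<And>\<phi>. \<phi> \<in> co ` B \<Longrightarrow> \<phi> v = 0\<close> by force
    moreover have "(\<Sum>b\<in>B. representation B v b *\<^sub>R b) = v"
      using B by (intro sum_representation_eq) auto
    ultimately show ?thesis by simp
  qed
  ultimately show thesis using that[of "co ` B"] B(1) by blast
qed

text \<open>Rounding down the coordinates of \<open>n x\<close> gives a lattice point
  \<open>u\<close> with \<open>u / n\<close> at distance at most \<open>N / n\<close> from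
  \<open>x\<close>, where \<open>N\<close> is the sum of the norms of the basis vectors.\<close>

lemma full_lattice_rational_dense:
  fixes M :: "'v::euclidean_space set"
  assumes "full_lattice M" "e > 0"
  shows "\<exists>n>0. \<exists>u\<in>M. dist ((1 / real n) *\<^sub>R u) x < e"
proof -
  obtain B where B: "finite B" "independent B" "span B = UNIV"
    "M = {\<Sum>b\<in>B. real_of_int (c b) *\<^sub>R b | c :: 'v \<Rightarrow> int. True}"
    by (rule full_lattice_basis[OF assms(1)])
  define r where "r = representation B x"
  have x: "(\<Sum>b\<in>B. r b *\<^sub>R b) = x"
    unfolding r_def using B by (intro sum_representation_eq) auto
  define N where "N = (\<Sum>b\<in>B. norm b)"
  obtain n :: nat where n: "N / e < real n" using reals_Archimedean2 by blast
  have "N \<ge> 0" unfolding N_def by (simp add: sum_nonneg)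
  then have "0 \<le> N / e" using \<open>e > 0\<close> by simp
  then have n0: "n > 0" using n by (cases n) auto
  define u where "u = (\<Sum>b\<in>B. real_of_int \<lfloor>real n * r b\<rfloor> *\<^sub>R b)"
  have "norm ((1 / real n) *\<^sub>R u - x) = norm (\<Sum>b\<in>B. (real_of_int \<lfloor>real n * r b\<rfloor> / real n - r b) *\<^sub>R b)"
    unfolding u_def x[symmetric] by (simp add: scaleR_sum_right sum_subtractf scaleR_diff_left)
  also have "\<dots> \<le> (\<Sum>b\<in>B. norm b / real n)"
  proof (rule sum_norm_le)
    fix b
    have "real_of_int \<lfloor>real n * r b\<rfloor> / real n - r b = (real_of_int \<lfloor>real n * r b\<rfloor> - real n * r b) / real n"
      using n0 by (simp add: field_simps)
    also have "\<bar>\<dots>\<bar> \<le> 1 / real n"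
      unfolding abs_divide using n0 by (intro divide_right_mono frac_le) (simp_all, linarith)
    finally show "norm ((real_of_int \<lfloor>real n * r b\<rfloor> / real n - r b) *\<^sub>R b) \<le> norm b / real n"
      using mult_right_mono[of _ "1 / real n" "norm b"] by fastforce
  qed
  also have "\<dots> = N / real n" by (simp add: N_def sum_divide_distrib)
  also have "\<dots> < e" using n n0 \<open>e > 0\<close> by (simp add: field_simps)
  finally have "dist ((1 / real n) *\<^sub>R u) x < e" by (simp add: dist_norm)
  moreover have "u \<in> M" unfolding u_def B(4) by (intro CollectI exI[of _ "\<lambda>b. \<lfloor>real n * r b\<rfloor>"]) simp
  ultimately show ?thesis using n0 by blast
qed

section \<open>Cones with the root property\<close>

lemma pos_cone_convex_add:
  fixes \<sigma> :: "'v::real_vector set"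
  assumes "pos_cone \<sigma>" "convex \<sigma>" "x \<in> \<sigma>" "y \<in> \<sigma>"
  shows "x + y \<in> \<sigma>"
proof -
  have "(1/2) *\<^sub>R x + (1/2) *\<^sub>R y \<in> \<sigma>" using assms by (intro convexD) auto
  then have "2 *\<^sub>R ((1/2) *\<^sub>R x + (1/2) *\<^sub>R y) \<in> \<sigma>"
    using assms(1) unfolding pos_cone_def by (metis zero_less_numeral)
  then show ?thesis by (simp add: scaleR_add_right)
qed

text \<open>For small \<open>d > 0\<close> the point \<open>m + d v\<close> is still in
  \<open>\<sigma>\<close>; rescaling by \<open>1 / d\<close> gives the claim.\<close>

lemma pos_cone_interior_absorbs:
  fixes \<sigma> :: "'v::real_normed_vector set"
  assumes "pos_cone \<sigma>" "m \<in> interior \<sigma>"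
  shows "\<exists>t>0. v + t *\<^sub>R m \<in> \<sigma>"
proof -
  obtain e where e: "e > 0" "ball m e \<subseteq> \<sigma>" using assms(2) by (auto simp: mem_interior)
  define d where "d = e / (2 * (norm v + 1))"
  have nv: "norm v + 1 > 0" by (simp add: add_nonneg_pos)
  then have d: "d > 0" using e by (simp add: d_def)
  have "norm (d *\<^sub>R v) \<le> e / 2"
  proof -
    have "d * norm v \<le> d * (norm v + 1)" using d by simp
    also have "\<dots> = e / 2" using nv by (simp add: d_def field_simps)
    finally show ?thesis using d by simp
  qed
  then have "m + d *\<^sub>R v \<in> \<sigma>" using e by (intro subsetD[OF e(2)]) (simp add: dist_norm)
  then have "(1 / d) *\<^sub>R (m + d *\<^sub>R v) \<in> \<sigma>"
    using assms(1) d unfolding pos_cone_def by simp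
  then show ?thesis using d by (intro exI[of _ "1 / d"]) (simp add: scaleR_add_right add.commute)
qed

text \<open>The function is \<open>fact q\<close> times \<open>h v = Sup {t. v - t m \<in> \<sigma>}\<close>. On \<open>M\<close>, \<open>h\<close> takes no value
  in \<open>(-1/q, 0)\<close>, and since \<open>h (n v + k m) = n h v + k\<close> this forces denominators at most \<open>q\<close>.\<close>
lemma root_closed_cone_superadditive:
  fixes M \<sigma> :: "'v::euclidean_space set"
  assumes M: "add_subgroup M" and cone: "pos_cone \<sigma>" and conv: "convex \<sigma>" and zero: "0 \<in> \<sigma>"
    and m: "m \<in> interior \<sigma>" "m \<in> M" and ne: "\<sigma> \<noteq> UNIV" and q: "q > 0"
    and root: "\<And>v. v \<in> M \<Longrightarrow> v + (1 / real q) *\<^sub>R m \<in> \<sigma> \<Longrightarrow> v \<in> \<sigma>"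
  shows "\<exists>f. superadditive M f \<and> M \<inter> \<sigma> = {v \<in> M. 0 \<le> f v}"
proof -
  note add = pos_cone_convex_add[OF cone conv]
  have scale: "t *\<^sub>R x \<in> \<sigma>" if "x \<in> \<sigma>" "t \<ge> 0" for t x
    using that cone zero unfolding pos_cone_def by (cases "t = 0") auto
  have m\<sigma>: "m \<in> \<sigma>" using m interior_subset by blast
  \<comment> \<open>Every vector enters the cone after adding a positive multiple of
    \<open>m\<close>; if \<open>- m\<close> were in the cone, that multiple could be removed
    again.\<close>
  have neg_m: "- m \<notin> \<sigma>"
  proof
    assume "- m \<in> \<sigma>"
    have "v \<in> \<sigma>" for v
    proof -
      obtain t where t: "t > 0" "v + t *\<^sub>R m \<in> \<sigma>"
        using pos_cone_interior_absorbs[OF cone m(1)] by blast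
      have "t *\<^sub>R (- m) \<in> \<sigma>" using t scale[OF \<open>- m \<in> \<sigma>\<close>, of t] by simp
      from add[OF t(2) this] show ?thesis by simp
    qed
    then show False using ne by blast
  qed
  define X where "X v = {t. v - t *\<^sub>R m \<in> \<sigma>}" for v
  define h where "h v = Sup (X v)" for v
  have X_ne: "X v \<noteq> {}" for v
  proof -
    obtain t where "v + t *\<^sub>R m \<in> \<sigma>" using pos_cone_interior_absorbs[OF cone m(1)] by blast
    then have "- t \<in> X v" by (simp add: X_def)
    then show ?thesis by blast
  qed
  have X_down: "s \<in> X v" if "t \<in> X v" "s \<le> t" for s t v
  proof -
    have "(v - t *\<^sub>R m) + (t - s) *\<^sub>R m \<in> \<sigma>"
      using that scale[OF m\<sigma>] by (intro add) (auto simp: X_def)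
    then show ?thesis by (simp add: X_def algebra_simps)
  qed
  \<comment> \<open>Some \<open>- v + s m\<close> lies in the cone. Adding \<open>v - t m\<close>
    with \<open>t > s\<close> would leave a positive multiple of \<open>- m\<close>.\<close>
  have X_bdd: "bdd_above (X v)" for v
  proof -
    obtain s where s: "- v + s *\<^sub>R m \<in> \<sigma>" using pos_cone_interior_absorbs[OF cone m(1)] by blast
    have "t \<le> s" if "t \<in> X v" for t
    proof (rule ccontr)
      assume "\<not> t \<le> s"
      have "(v - t *\<^sub>R m) + (- v + s *\<^sub>R m) \<in> \<sigma>"
        using that unfolding X_def by (intro add s) simp
      then have "(1 / (t - s)) *\<^sub>R ((v - t *\<^sub>R m) + (- v + s *\<^sub>R m)) \<in> \<sigma>"
        using \<open>\<not> t \<le> s\<close> by (intro scale) auto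
      moreover have "(v - t *\<^sub>R m) + (- v + s *\<^sub>R m) = (t - s) *\<^sub>R (- m)"
        by (simp add: algebra_simps)
      ultimately show False using neg_m \<open>\<not> t \<le> s\<close> by simp
    qed
    then show ?thesis by (rule bdd_aboveI)
  qed
  have h_upper: "t \<le> h v" if "v - t *\<^sub>R m \<in> \<sigma>" for t v
    unfolding h_def using that X_bdd by (intro cSup_upper) (auto simp: X_def)
  have h_lower: "v - t *\<^sub>R m \<in> \<sigma>" if t: "t < h v" for t v
  proof -
    obtain s where "s \<in> X v" "t < s"
      using less_cSupD[OF X_ne t[unfolded h_def]] by blast
    then have "t \<in> X v" using X_down by simp
    then show ?thesis by (simp add: X_def)
  qed
  \<comment> \<open>Since \<open>\<sigma>\<close> need not be closed, the supremum need not be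
    attained; these estimates use points slightly below it and let the defect tend to
    \<open>0\<close>.\<close>
  have h_add: "h u + h v \<le> h (u + v)" for u v
  proof (rule field_le_epsilon)
    fix e :: real assume "e > 0"
    then have "(u - (h u - e/2) *\<^sub>R m) + (v - (h v - e/2) *\<^sub>R m) \<in> \<sigma>"
      by (intro add h_lower) auto
    moreover have "(u - a *\<^sub>R m) + (v - b *\<^sub>R m) = (u + v) - (a + b) *\<^sub>R m" for a b
      by (simp add: algebra_simps)
    moreover have "(h u - e/2) + (h v - e/2) = h u + h v - e" by simp
    ultimately have "(u + v) - (h u + h v - e) *\<^sub>R m \<in> \<sigma>" by metis
    then show "h u + h v \<le> h (u + v) + e" using h_upper[of "u + v" "h u + h v - e"] by simp
  qed
  have h_scale_le: "c * h v \<le> h (c *\<^sub>R v)" if "c > 0" for c v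
  proof (rule field_le_epsilon)
    fix e :: real assume "e > 0"
    then have "c *\<^sub>R (v - (h v - e / c) *\<^sub>R m) \<in> \<sigma>"
      using that by (intro scale h_lower) auto
    moreover have "c *\<^sub>R (v - (h v - e / c) *\<^sub>R m) = c *\<^sub>R v - (c * h v - e) *\<^sub>R m"
      using that by (simp add: scaleR_diff_right right_diff_distrib)
    ultimately show "c * h v \<le> h (c *\<^sub>R v) + e" using h_upper[of "c *\<^sub>R v" "c * h v - e"] by simp
  qed
  have h_zero: "h 0 = 0"
  proof (rule antisym)
    show "0 \<le> h 0" using h_upper[of 0 0] zero by simp
    show "h 0 \<le> 0"
    proof (rule ccontr)
      assume "\<not> h 0 \<le> 0"
      then have "0 - (h 0 / 2) *\<^sub>R m \<in> \<sigma>" by (intro h_lower) auto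
      then have "(2 / h 0) *\<^sub>R (0 - (h 0 / 2) *\<^sub>R m) \<in> \<sigma>"
        using \<open>\<not> h 0 \<le> 0\<close> by (intro scale) auto
      then show False using neg_m \<open>\<not> h 0 \<le> 0\<close> by simp
    qed
  qed
  have h_scale: "h (c *\<^sub>R v) = c * h v" if "c \<ge> 0" for c v
  proof (cases "c = 0")
    case False
    then have "c > 0" using that by simp
    then have "(1 / c) * h (c *\<^sub>R v) \<le> h v"
      using h_scale_le[of "1 / c" "c *\<^sub>R v"] by simp
    then show ?thesis using h_scale_le[OF \<open>c > 0\<close>, of v] \<open>c > 0\<close> by (simp add: field_simps)
  qed (simp add: h_zero)
  have h_shift_ge: "h v + t \<le> h (v + t *\<^sub>R m)" for v t
  proof (rule field_le_epsilon)
    fix e :: real assume "e > 0"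
    then have "v - (h v - e) *\<^sub>R m \<in> \<sigma>" by (intro h_lower) auto
    moreover have "v - (h v - e) *\<^sub>R m = (v + t *\<^sub>R m) - (h v + t - e) *\<^sub>R m"
      by (simp add: algebra_simps)
    ultimately show "h v + t \<le> h (v + t *\<^sub>R m) + e"
      using h_upper[of "v + t *\<^sub>R m" "h v + t - e"] by simp
  qed
  have h_shift: "h (v + t *\<^sub>R m) = h v + t" for v t
    using h_shift_ge[of v t] h_shift_ge[of "v + t *\<^sub>R m" "- t"] by simp
  \<comment> \<open>\<open>h v > - 1 / q\<close> puts \<open>v + m / q\<close> into the cone, so
    \<open>root\<close> applies. In particular lattice points with \<open>h v = 0\<close> are in
    \<open>\<sigma>\<close>, although closedness is not yet known.\<close>
  have mem: "v \<in> \<sigma>" if "v \<in> M" "h v > - 1 / q" for v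
    using h_lower[of "- 1 / q" v] that root by simp
  have mem_iff: "v \<in> \<sigma> \<longleftrightarrow> h v \<ge> 0" if "v \<in> M" for v
  proof
    show "h v \<ge> 0" if "v \<in> \<sigma>" using h_upper[of v 0] that by simp
    show "v \<in> \<sigma>" if "h v \<ge> 0"
    proof (rule mem[OF \<open>v \<in> M\<close>])
      have "- 1 / real q < 0" using q by simp
      then show "h v > - 1 / q" using that by linarith
    qed
  qed
  have integral: "of_int (fact q) * h v \<in> \<int>" if v: "v \<in> M" for v
  proof (rule rational_if_multiples_avoid_gap[OF q])
    fix n :: nat and k :: int
    \<comment> \<open>The numbers \<open>n h v + k\<close> are themselves values of \<open>h\<close>
      at lattice points, so they inherit the gap.\<close>
    define w where "w = real n *\<^sub>R v + real_of_int k *\<^sub>R m"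
    have hw: "h w = real n * h v + of_int k" by (simp add: w_def h_shift h_scale)
    have "w \<in> M"
      unfolding w_def using add_subgroup_scale_int[OF M v, of "int n"]
        add_subgroup_scale_int[OF M m(2), of k]
      by (intro add_subgroup_add[OF M]) auto
    moreover assume "real n * h v + of_int k > - 1 / q"
    ultimately show "real n * h v + of_int k \<ge> 0" using mem[of w] mem_iff[of w] hw by simp
  qed
  define f where "f v = \<lfloor>of_int (fact q) * h v\<rfloor>" for v
  have f: "real_of_int (f v) = of_int (fact q) * h v" if "v \<in> M" for v
    using integral[OF that] unfolding f_def by (metis Ints_cases floor_of_int)
  have fact_pos: "real_of_int (fact q) > 0" by simp
  have "superadditive M f"
  proof
    show "add_subgroup M" by fact
    show "f u + f v \<le> f (u + v)" if "u \<in> M" "v \<in> M" for u v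
    proof -
      have "real_of_int (f u + f v) \<le> real_of_int (f (u + v))"
        using mult_left_mono[OF h_add[of u v], of "of_int (fact q)"] that add_subgroup_add[OF M that]
        by (simp add: f distrib_left del: of_int_fact)
      then show ?thesis by (simp only: of_int_le_iff)
    qed
    show "f (real n *\<^sub>R u) = int n * f u" if u: "u \<in> M" for n u
    proof -
      have "real n *\<^sub>R u \<in> M" using add_subgroup_scale_int[OF M u, of "int n"] by simp
      then have "real_of_int (f (real n *\<^sub>R u)) = real_of_int (int n * f u)"
        using u by (simp add: f h_scale del: of_int_fact)
      then show ?thesis by (simp only: of_int_eq_iff)
    qed
  qed
  moreover have "v \<in> \<sigma> \<longleftrightarrow> 0 \<le> f v" if v: "v \<in> M" for v
  proof -
    have "0 \<le> f v \<longleftrightarrow> 0 \<le> real_of_int (f v)" by simp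
    also have "\<dots> \<longleftrightarrow> 0 \<le> h v"
      unfolding f[OF v] zero_le_mult_iff using fact_pos by linarith
    finally show ?thesis using mem_iff[OF v] by simp
  qed
  then have "M \<inter> \<sigma> = {v \<in> M. 0 \<le> f v}" by blast
  ultimately show ?thesis by blast
qed

section \<open>Generated cones and approximation by lattice points\<close>

lemma generated_convex_cone_subset:
  fixes \<sigma> :: "'v::real_vector set"
  assumes "pos_cone \<sigma>" "convex \<sigma>" "0 \<in> \<sigma>" "T \<subseteq> \<sigma>"
  shows "generated_convex_cone T \<subseteq> \<sigma>"
proof -
  have "(\<Sum>i\<in>I. t i *\<^sub>R s i) \<in> \<sigma>"
    if "finite I" "\<forall>i\<in>I. s i \<in> T \<and> t i > 0" for I :: "nat set" and t :: "nat \<Rightarrow> real" and s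
    using that
  proof induction
    case (insert i I)
    have "t i *\<^sub>R s i \<in> \<sigma>" using insert.prems assms unfolding pos_cone_def by auto
    then show ?case using insert pos_cone_convex_add[OF assms(1,2)] by simp
  qed (use assms in simp)
  then show ?thesis unfolding generated_convex_cone_def by auto
qed

text \<open>The hull contains \<open>0\<close>, which strictly positive combinations need not
  produce unless \<open>0\<close> is among the generators.\<close>

lemma generated_convex_cone_eq_hull:
  fixes T :: "'v::real_vector set"
  assumes "0 \<in> T"
  shows "generated_convex_cone T = convex_cone hull T"
proof
  have "convex_cone (convex_cone hull T)" by (rule convex_cone_convex_cone_hull)
  then show "generated_convex_cone T \<subseteq> convex_cone hull T"
    by (intro generated_convex_cone_subset)
      (auto simp: convex_cone_def conic_def pos_cone_def hull_inc assms)
next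
  let ?C = "generated_convex_cone T"
  have I: "(\<Sum>i=1..r. t i *\<^sub>R s i) \<in> ?C" if "r \<ge> 1" "\<forall>i\<in>{1..r}. s i \<in> T \<and> t i > 0"
    for r :: nat and t :: "nat \<Rightarrow> real" and s
    using that unfolding generated_convex_cone_def by blast
  have T: "T \<subseteq> ?C"
  proof
    fix x assume "x \<in> T"
    then show "x \<in> ?C" using I[of 1 "\<lambda>_. x" "\<lambda>_. 1"] by simp
  qed
  have "x + y \<in> ?C" if xy: "x \<in> ?C" "y \<in> ?C" for x y
  proof -
    obtain r :: nat and t s where x: "r \<ge> 1" "\<forall>i\<in>{1..r}. s i \<in> T \<and> t i > 0" "x = (\<Sum>i=1..r. t i *\<^sub>R s i)"
      using xy(1) unfolding generated_convex_cone_def by blast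
    obtain r' :: nat and t' s' where y: "r' \<ge> 1" "\<forall>i\<in>{1..r'}. s' i \<in> T \<and> t' i > 0"
      "y = (\<Sum>i=1..r'. t' i *\<^sub>R s' i)"
      using \<open>y \<in> ?C\<close> unfolding generated_convex_cone_def by blast
    \<comment> \<open>The two combinations are concatenated, the second one shifted by
      \<open>r\<close>.\<close>
    define t'' where "t'' i = (if i \<le> r then t i else t' (i - r))" for i
    define s'' where "s'' i = (if i \<le> r then s i else s' (i - r))" for i
    have "(\<Sum>i=1..r+r'. t'' i *\<^sub>R s'' i) =
        (\<Sum>i=1..r. t'' i *\<^sub>R s'' i) + (\<Sum>i=r+1..r+r'. t'' i *\<^sub>R s'' i)"
      using x(1) by (intro sum.ub_add_nat) simp
    also have "(\<Sum>i=1..r. t'' i *\<^sub>R s'' i) = x"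
      unfolding x(3) by (rule sum.cong) (auto simp: t''_def s''_def)
    also have "(\<Sum>i=r+1..r+r'. t'' i *\<^sub>R s'' i) = (\<Sum>i=1..r'. t'' (i + r) *\<^sub>R s'' (i + r))"
      using sum.shift_bounds_cl_nat_ivl[of "\<lambda>i. t'' i *\<^sub>R s'' i" 1 r r'] by (simp add: add.commute)
    also have "\<dots> = y"
      unfolding y(3) by (rule sum.cong) (auto simp: t''_def s''_def)
    finally have "x + y = (\<Sum>i=1..r+r'. t'' i *\<^sub>R s'' i)" by simp
    moreover have "s'' i \<in> T \<and> t'' i > 0" if "i \<in> {1..r+r'}" for i
    proof (cases "i \<le> r")
      case True
      then show ?thesis using that x(2) by (simp add: t''_def s''_def)
    next
      case False
      then have "i - r \<in> {1..r'}" using that by auto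
      then show ?thesis using False y(2) by (simp add: t''_def s''_def)
    qed
    ultimately show ?thesis using I[of "r + r'" s'' t''] x(1) by simp
  qed
  moreover have "c *\<^sub>R x \<in> ?C" if "x \<in> ?C" "c \<ge> 0" for c x
  proof (cases "c = 0")
    case True
    then show ?thesis using T assms by auto
  next
    case False
    obtain r :: nat and t s where x: "r \<ge> 1" "\<forall>i\<in>{1..r}. s i \<in> T \<and> t i > 0" "x = (\<Sum>i=1..r. t i *\<^sub>R s i)"
      using \<open>x \<in> ?C\<close> unfolding generated_convex_cone_def by blast
    then have "c *\<^sub>R x = (\<Sum>i=1..r. (c * t i) *\<^sub>R s i)" by (simp add: scaleR_sum_right)
    then show ?thesis using I[of r s "\<lambda>i. c * t i"] x False \<open>c \<ge> 0\<close> by simp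
  qed
  ultimately have "convex_cone ?C" using T assms by (auto simp: convex_cone_iff)
  then show "convex_cone hull T \<subseteq> ?C" using T by (intro hull_minimal)
qed

text \<open>A spanning convex set containing \<open>0\<close> has nonempty interior. A rational
  point \<open>u / n\<close> of that interior, scaled by \<open>n\<close>, is a lattice point, and
  it stays in the interior because the scaled interior is an open subset of the cone.\<close>

lemma full_lattice_meets_interior:
  fixes M :: "'v::euclidean_space set"
  assumes M: "full_lattice M" and cone: "pos_cone \<sigma>" and "convex \<sigma>" "0 \<in> \<sigma>" "span \<sigma> = UNIV"
  obtains m where "m \<in> M" "m \<in> interior \<sigma>"
proof -
  have "affine hull \<sigma> = UNIV" using assms by (simp add: affine_hull_span_0 hull_inc)
  then have "interior \<sigma> \<noteq> {}"
    using assms rel_interior_interior[of \<sigma>] rel_interior_eq_empty[of \<sigma>] by auto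
  then obtain x where "x \<in> interior \<sigma>" by blast
  then obtain e where e: "e > 0" "ball x e \<subseteq> interior \<sigma>"
    by (meson open_interior open_contains_ball)
  obtain n u where n: "n > 0" "u \<in> M" "dist ((1 / real n) *\<^sub>R u) x < e"
    using full_lattice_rational_dense[OF M e(1), of x] by blast
  then have "(1 / real n) *\<^sub>R u \<in> interior \<sigma>" using e by (auto simp: dist_commute)
  then have "real n *\<^sub>R ((1 / real n) *\<^sub>R u) \<in> (*\<^sub>R) (real n) ` interior \<sigma>" by (rule imageI)
  moreover have "(*\<^sub>R) (real n) ` interior \<sigma> \<subseteq> interior \<sigma>"
  proof (rule interior_maximal)
    show "(*\<^sub>R) (real n) ` interior \<sigma> \<subseteq> \<sigma>"
      using cone n(1) interior_subset unfolding pos_cone_def by force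
    show "open ((*\<^sub>R) (real n) ` interior \<sigma>)"
      using n(1) by (intro open_scaling) auto
  qed
  ultimately have "u \<in> interior \<sigma>" using n(1) by auto
  then show thesis using that n(2) by blast
qed

text \<open>Rational points near an interior point lie on rays through lattice points of
  \<open>\<sigma>\<close>, hence in \<open>C\<close>. Closedness of \<open>C\<close> adds the
  interior, and a convex set with nonempty interior lies in the closure of that interior.\<close>

lemma convex_subset_closed_cone_if_lattice_points:
  fixes M :: "'v::euclidean_space set"
  assumes M: "full_lattice M" and cone: "pos_cone \<sigma>" and conv: "convex \<sigma>"
    and ne: "interior \<sigma> \<noteq> {}" and C: "closed C" "pos_cone C" "\<sigma> \<inter> M \<subseteq> C"
  shows "\<sigma> \<subseteq> C"
proof -
  have "interior \<sigma> \<subseteq> C"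
  proof
    fix x assume "x \<in> interior \<sigma>"
    then obtain d where d: "d > 0" "ball x d \<subseteq> \<sigma>" by (auto simp: mem_interior)
    have "\<exists>y\<in>C. dist y x < e" if "e > 0" for e
    proof -
      have "min d e > 0" using d that by simp
      then obtain n u where n: "n > 0" "u \<in> M" "dist ((1 / real n) *\<^sub>R u) x < min d e"
        using full_lattice_rational_dense[OF M] by blast
      then have "(1 / real n) *\<^sub>R u \<in> \<sigma>" using d by (auto simp: dist_commute)
      then have "real n *\<^sub>R ((1 / real n) *\<^sub>R u) \<in> \<sigma>"
        using cone n(1) unfolding pos_cone_def by (metis of_nat_0_less_iff)
      then have "u \<in> C" using n C(3) by auto
      then have "(1 / real n) *\<^sub>R u \<in> C" using C(2) n(1) unfolding pos_cone_def by simp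
      then show ?thesis using n(3) by auto
    qed
    then have "x \<in> closure C" by (simp add: closure_approachable)
    then show "x \<in> C" using C(1) by simp
  qed
  then have "closure (interior \<sigma>) \<subseteq> C" using C(1) by (simp add: closure_minimal)
  then show ?thesis using convex_closure_interior[OF conv ne] closure_subset by auto
qed

section \<open>From a splitting to finitely many generators\<close>

theorem mainTheorem2:
  fixes p :: nat
    and M \<sigma> :: "'v::euclidean_space set"
  assumes "CHAR('k::field) = p" and "p > 0"
    and "full_lattice M"
    and "pos_cone \<sigma>" and "convex \<sigma>" and "0 \<in> \<sigma>" and "span \<sigma> = UNIV"
    and "split_F_regular (monoid_algebra (\<sigma> \<inter> M) :: ('v \<Rightarrow>\<^sub>0 'k) ring)"
  shows "(closed \<sigma> \<and> (\<exists>T. finite T \<and> T \<subseteq> \<sigma> \<inter> M \<and> \<sigma> = generated_convex_cone T)) \<and>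
         finite_type_algebra scalars (monoid_algebra (\<sigma> \<inter> M) :: ('v \<Rightarrow>\<^sub>0 'k) ring)"
proof -
  note lattice = \<open>full_lattice M\<close> and cone = \<open>pos_cone \<sigma>\<close> and conv = \<open>convex \<sigma>\<close>
    and zero = \<open>0 \<in> \<sigma>\<close> and reg = assms(8)
  note M = full_lattice_add_subgroup[OF lattice]
  have scale: "t *\<^sub>R x \<in> \<sigma>" if "x \<in> \<sigma>" "t \<ge> 0" for t x
    using that cone zero unfolding pos_cone_def by (cases "t = 0") auto
  have nat_mult: "real n *\<^sub>R x \<in> M" if "x \<in> M" for n x
    using add_subgroup_scale_int[OF M that, of "int n"] by simp
  obtain m where m: "m \<in> M" "m \<in> interior \<sigma>"
    using full_lattice_meets_interior[OF lattice cone conv zero \<open>span \<sigma> = UNIV\<close>] .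
  then have mS: "m \<in> \<sigma> \<inter> M" using interior_subset by blast
  have S_add: "x + y \<in> \<sigma> \<inter> M" if "x \<in> \<sigma> \<inter> M" "y \<in> \<sigma> \<inter> M" for x y
    using that pos_cone_convex_add[OF cone conv] add_subgroup_add[OF M] by auto
  obtain q where q: "q > 0"
    and qS: "\<forall>u\<in>\<sigma> \<inter> M. \<forall>w\<in>\<sigma> \<inter> M. m + real q *\<^sub>R (u - w) \<in> \<sigma> \<inter> M \<longrightarrow> u - w \<in> \<sigma> \<inter> M"
    using split_F_regular_root_closed[OF reg S_add mS] by blast
  \<comment> \<open>For large \<open>n\<close> both terms of \<open>v = (v + n m) - n m\<close> lie
    in \<open>\<sigma> \<inter> M\<close>, because \<open>m\<close> is interior. Scaling
    \<open>v + m / q\<close> by \<open>q\<close> gives the element \<open>m + q v\<close> that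
    \<open>qS\<close> requires.\<close>
  have root: "v \<in> \<sigma>" if v: "v \<in> M" "v + (1 / real q) *\<^sub>R m \<in> \<sigma>" for v
  proof -
    obtain t where t: "t > 0" "v + t *\<^sub>R m \<in> \<sigma>"
      using pos_cone_interior_absorbs[OF cone m(2)] by blast
    obtain n :: nat where n: "t \<le> real n" using real_arch_simple by blast
    have "(v + t *\<^sub>R m) + (real n - t) *\<^sub>R m \<in> \<sigma>"
      using pos_cone_convex_add[OF cone conv t(2)] scale[of m "real n - t"] mS n by simp
    then have "v + real n *\<^sub>R m \<in> \<sigma> \<inter> M"
      using add_subgroup_add[OF M v(1) nat_mult[OF m(1)]] by (simp add: algebra_simps)
    moreover have "real n *\<^sub>R m \<in> \<sigma> \<inter> M"
      using nat_mult[OF m(1)] scale[of m] mS by simp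
    moreover have "m + real q *\<^sub>R v \<in> \<sigma> \<inter> M"
    proof -
      have "real q *\<^sub>R (v + (1 / real q) *\<^sub>R m) \<in> \<sigma>" using scale[OF v(2)] by simp
      then show ?thesis
        using q add_subgroup_add[OF M m(1) nat_mult[OF v(1)]] by (simp add: scaleR_add_right add.commute)
    qed
    moreover have "v + real n *\<^sub>R m - real n *\<^sub>R m = v" by simp
    ultimately show ?thesis using qS by (metis IntD1)
  qed
  obtain L where L: "finite L" "\<forall>\<phi>\<in>L. add_on M \<phi>" "\<sigma> \<inter> M = {v \<in> M. \<forall>\<phi>\<in>L. 0 \<le> \<phi> v}"
  proof (cases "\<sigma> = UNIV")
    case True
    \<comment> \<open>The whole space is cut out by no inequalities; the function \<open>h\<close>
      would be infinite there.\<close>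
    then show thesis using that[of "{}"] by auto
  next
    case False
    obtain f where f: "superadditive M f" "M \<inter> \<sigma> = {v \<in> M. 0 \<le> f v}"
      using root_closed_cone_superadditive[OF M cone conv zero m(2,1) False q root] by blast
    obtain A where A: "finite A" "A \<subseteq> M" "M \<subseteq> add_subgroup hull A"
      using full_lattice_generators[OF lattice] .
    from nonneg_locus_finitely_cut_out[OF f(1) A] show thesis
      by (elim exE conjE) (rule that, simp_all add: f(2)[symmetric] Int_commute)
  qed
  obtain D where D: "finite D" "\<And>\<phi>. \<phi> \<in> D \<Longrightarrow> add_on M \<phi>"
    "\<And>v. v \<in> M \<Longrightarrow> (\<And>\<phi>. \<phi> \<in> D \<Longrightarrow> \<phi> v = 0) \<Longrightarrow> v = 0"
    by (rule full_lattice_coordinates[OF lattice]) blast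
  have "\<exists>B\<subseteq>\<sigma> \<inter> M. finite B \<and> \<sigma> \<inter> M \<subseteq> monoid_gen B"
    unfolding L(3) using L(2) D by (intro Gordan[OF M L(1) D(1)]) auto
  then obtain B where B: "B \<subseteq> \<sigma> \<inter> M" "finite B" "\<sigma> \<inter> M \<subseteq> monoid_gen B" by blast
  have zero_S: "0 \<in> \<sigma> \<inter> M" using zero M by (simp add: add_subgroup_def)
  \<comment> \<open>Adding \<open>0\<close> identifies the cone generated by \<open>T\<close> with
    \<open>convex_cone hull T\<close>, which is closed because \<open>T\<close> is finite.\<close>
  define T where "T = insert 0 B"
  have T: "finite T" "T \<subseteq> \<sigma> \<inter> M" "0 \<in> T" using B zero_S by (auto simp: T_def)
  define C where "C = convex_cone hull T"
  have C: "convex_cone C" "closed C" "T \<subseteq> C"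
    using T(1) by (auto simp: C_def convex_cone_convex_cone_hull closed_convex_cone_hull hull_inc)
  have "x \<in> C" if "x \<in> monoid_gen B" for x
    using that by induction (use C(1,3) in \<open>auto simp: T_def convex_cone_iff\<close>)
  then have "\<sigma> \<inter> M \<subseteq> C" using B(3) by blast
  moreover have "pos_cone C" using C(1) by (simp add: pos_cone_def convex_cone_iff)
  ultimately have "\<sigma> \<subseteq> C"
    using convex_subset_closed_cone_if_lattice_points[OF lattice cone conv _ C(2)] m(2) by blast
  moreover have gen: "generated_convex_cone T = C"
    unfolding C_def by (rule generated_convex_cone_eq_hull[OF T(3)])
  moreover have "generated_convex_cone T \<subseteq> \<sigma>"
    using T(2) by (intro generated_convex_cone_subset[OF cone conv zero]) auto
  ultimately have \<sigma>: "\<sigma> = C" by blast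
  have "finite_type_algebra scalars (monoid_algebra (\<sigma> \<inter> M) :: ('v \<Rightarrow>\<^sub>0 'k) ring)"
  proof (rule finite_type_monoid_algebra)
    have "domain (monoid_algebra (\<sigma> \<inter> M) :: ('v \<Rightarrow>\<^sub>0 'k) ring)"
      using reg by (simp add: split_F_regular_def)
    then show "ring (monoid_algebra (\<sigma> \<inter> M) :: ('v \<Rightarrow>\<^sub>0 'k) ring)"
      by (intro cring.axioms(1) domain.axioms(1))
  qed (use B zero_S in auto)
  then show ?thesis using \<sigma> C(2) gen T by metis
qed

end
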